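(* Every simple graph $G$ of positive size $s$ satisfying $\operatorname{FR}_{\min}(G)=\mathcal E(G)/\sqrt{2s}$ is regular.
   Context: Graphs are finite, simple and undirected. A vertex labeling of a graph $G=(V,E)$ of order $N=|V|$ is a bijection $\sigma:V\to\mathbb Z_N=\mathbb Z/N\mathbb Z$. The adjacency matrix under $\sigma$ is the $N\times N$ matrix $A_\sigma$, indexed by $\mathbb Z_N\times\mathbb Z_N$, with $(A_\sigma)_{x,y}=1$ if the vertices labeled $x$ and $y$ are adjacent and $0$ otherwise. $F$ is the unitary Fourier matrix $F_{mx}=\frac1{\sqrt N}e^{-2\pi i mx/N}$. The Fourier ratio of a nonzero $N\times N$ matrix $M$ is $\operatorname{FR}(M)=\|FMF\|_1/\|FMF\|_2$, where $\|\cdot\|_1$ is the entrywise $\ell^1$-norm and $\|\cdot\|_2$ the Frobenius norm. The edge complexity is $\operatorname{FR}_{\min}(G)=\min_\sigma\operatorname{FR}(A_\sigma)$, the minimum over all vertex labelings. The size $s$ is the number of edges, and the graph energy $\mathcal E(G)$ is the sum of the absolute values of the adjacency eigenvalues counted with multiplicity. *)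

theory Defs
  imports
    Complex_Main
    "Graph_Theory.Pair_Digraph"
    "Jordan_Normal_Form.Spectral_Radius"
begin

text \<open>
  Finite simple undirected graphs are the graphs of \<^locale>\<open>pair_graph\<close>: the vertex set
  \<^term>\<open>pverts G\<close> is finite and the adjacency relation \<^term>\<open>parcs G\<close> is symmetric and
  irreflexive.  As each edge occurs in \<^term>\<open>parcs G\<close> in both directions, edges are counted
  as two-element vertex sets.  The residues modulo the order are represented by
  \<open>{0..<N}\<close>, the index range of square matrices of dimension \<open>N\<close>.
\<close>

definition graph_order :: "'a pair_pre_digraph \<Rightarrow> nat" where
  "graph_order G = card (pverts G)"

definition graph_edges :: "'a pair_pre_digraph \<Rightarrow> 'a set set" where
  "graph_edges G = {{u, v} | u v. (u, v) \<in> parcs G}"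

definition graph_size :: "'a pair_pre_digraph \<Rightarrow> nat" where
  "graph_size G = card (graph_edges G)"

definition degree_of :: "'a pair_pre_digraph \<Rightarrow> 'a \<Rightarrow> nat" where
  "degree_of G v = card {u. (v, u) \<in> parcs G}"

definition regular_graph :: "'a pair_pre_digraph \<Rightarrow> bool" where
  "regular_graph G \<longleftrightarrow> (\<exists>d. \<forall>v\<in>pverts G. degree_of G v = d)"

definition labeling :: "'a pair_pre_digraph \<Rightarrow> ('a \<Rightarrow> nat) \<Rightarrow> bool" where
  "labeling G \<sigma> \<longleftrightarrow> bij_betw \<sigma> (pverts G) {0..<graph_order G}"

definition adjacency_mat :: "'a pair_pre_digraph \<Rightarrow> ('a \<Rightarrow> nat) \<Rightarrow> complex mat" where
  "adjacency_mat G \<sigma> = mat (graph_order G) (graph_order G)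
     (\<lambda>(x, y). if (inv_into (pverts G) \<sigma> x, inv_into (pverts G) \<sigma> y) \<in> parcs G then 1 else 0)"

definition fourier_mat :: "nat \<Rightarrow> complex mat" where
  "fourier_mat N = mat N N
     (\<lambda>(m, x). exp (- 2 * of_real pi * \<i> * of_nat m * of_nat x / of_nat N) / of_real (sqrt (real N)))"

definition entrywise_l1_norm :: "complex mat \<Rightarrow> real" where
  "entrywise_l1_norm M = (\<Sum>i<dim_row M. \<Sum>j<dim_col M. cmod (M $$ (i, j)))"

definition frobenius_norm :: "complex mat \<Rightarrow> real" where
  "frobenius_norm M = sqrt (\<Sum>i<dim_row M. \<Sum>j<dim_col M. (cmod (M $$ (i, j)))\<^sup>2)"

text \<open>Meaningful for nonzero square matrices only; the zero matrix gets the value 0.\<close>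

definition fourier_ratio :: "complex mat \<Rightarrow> real" where
  "fourier_ratio M =
     (let F = fourier_mat (dim_row M)
      in entrywise_l1_norm (F * M * F) / frobenius_norm (F * M * F))"

definition edge_complexity :: "'a pair_pre_digraph \<Rightarrow> real" where
  "edge_complexity G = Min {fourier_ratio (adjacency_mat G \<sigma>) | \<sigma>. labeling G \<sigma>}"

text \<open>
  Eigenvalues are weighted by algebraic multiplicity, which for the (real symmetric)
  adjacency matrices coincides with the geometric one.
\<close>

definition mat_energy :: "complex mat \<Rightarrow> real" where
  "mat_energy A = (\<Sum>k\<in>spectrum A. real (Polynomial.order k (char_poly A)) * cmod k)"

text \<open>The choice of the labeling is irrelevant, see \<open>graph_energy_eq\<close> below.\<close>

definition graph_energy :: "'a pair_pre_digraph \<Rightarrow> real" where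
  "graph_energy G = mat_energy (adjacency_mat G (SOME \<sigma>. labeling G \<sigma>))"

lemma adjacency_mat_carrier: "adjacency_mat G \<sigma> \<in> carrier_mat (graph_order G) (graph_order G)"
  by (simp add: adjacency_mat_def)

lemma adjacency_mat_entry:
  assumes "labeling G \<sigma>" "u \<in> pverts G" "v \<in> pverts G"
  shows "adjacency_mat G \<sigma> $$ (\<sigma> u, \<sigma> v) = (if (u, v) \<in> parcs G then 1 else 0)"
proof -
  have "\<sigma> u < graph_order G" "\<sigma> v < graph_order G"
    using assms by (auto simp: labeling_def bij_betw_def)
  then show ?thesis
    using assms by (simp add: adjacency_mat_def labeling_def bij_betw_inv_into_left)
qed

lemma labeling_exists:
  assumes "pair_graph G"
  shows "\<exists>\<sigma>. labeling G \<sigma>"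
proof -
  interpret pair_graph G by fact
  show ?thesis
    unfolding labeling_def graph_order_def by (rule ex_bij_betw_finite_nat[OF pair_finite_verts])
qed

lemma edge_complexity_set:
  assumes "pair_graph G"
  defines "S \<equiv> {fourier_ratio (adjacency_mat G \<sigma>) | \<sigma>. labeling G \<sigma>}"
  shows "finite S" "S \<noteq> {}"
proof -
  let ?n = "graph_order G"
  let ?I = "{0..<?n} \<times> {0..<?n}"
  let ?h = "\<lambda>R. fourier_ratio (mat ?n ?n (\<lambda>p. if p \<in> R then 1 else 0))"
  have "S \<subseteq> ?h ` Pow ?I"
  proof
    fix r assume "r \<in> S"
    then obtain \<sigma> where r: "r = fourier_ratio (adjacency_mat G \<sigma>)" unfolding S_def by blast
    let ?R = "{p \<in> ?I. adjacency_mat G \<sigma> $$ p = 1}"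
    have "adjacency_mat G \<sigma> = mat ?n ?n (\<lambda>p. if p \<in> ?R then 1 else 0)"
      by (rule eq_matI) (auto simp: adjacency_mat_def)
    then have "r = ?h ?R" using r by simp
    then show "r \<in> ?h ` Pow ?I" by blast
  qed
  then show "finite S" by (rule finite_subset) simp
  show "S \<noteq> {}" using labeling_exists[OF assms(1)] unfolding S_def by blast
qed

lemma adjacency_mat_similar:
  assumes "labeling G \<sigma>" "labeling G \<tau>"
  shows "similar_mat (adjacency_mat G \<sigma>) (adjacency_mat G \<tau>)"
proof -
  let ?V = "pverts G" and ?n = "graph_order G"
  let ?s = "inv_into ?V \<sigma>" and ?t = "inv_into ?V \<tau>"
  let ?P = "mat ?n ?n (\<lambda>(x, z). if ?s x = ?t z then 1 else 0) :: complex mat"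
  let ?Q = "mat ?n ?n (\<lambda>(z, x). if ?s x = ?t z then 1 else 0) :: complex mat"
  have s: "bij_betw ?s {0..<?n} ?V" and t: "bij_betw ?t {0..<?n} ?V"
    using assms by (auto simp: labeling_def intro: bij_betw_inv_into)
  have sV: "?s x \<in> ?V" and tV: "?t x \<in> ?V" if "x < ?n" for x
    using s t that by (auto simp: bij_betw_def)
  have sigma_lt: "\<sigma> v < ?n" and tau_lt: "\<tau> v < ?n" if "v \<in> ?V" for v
    using assms that by (auto simp: labeling_def bij_betw_def)
  have s_eq: "?s (\<sigma> v) = v" and t_eq: "?t (\<tau> v) = v" if "v \<in> ?V" for v
    using assms that by (simp_all add: labeling_def bij_betw_inv_into_left)
  have s_eq': "\<sigma> (?s x) = x" and t_eq': "\<tau> (?t x) = x" if "x < ?n" for x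
    using assms that by (simp_all add: labeling_def bij_betw_inv_into_right)
  have s_iff: "v = ?s x \<longleftrightarrow> x = \<sigma> v" and t_iff: "v = ?t x \<longleftrightarrow> x = \<tau> v"
    if "x < ?n" "v \<in> ?V" for x v
    using s_eq[OF that(2)] s_eq'[OF that(1)] t_eq[OF that(2)] t_eq'[OF that(1)] by metis+
  have t_sum: "(\<Sum>z = 0..<?n. if ?s x = ?t z then f z else 0) = f (\<tau> (?s x))"
    if x: "x < ?n" for x and f :: "nat \<Rightarrow> complex"
  proof -
    have "(\<Sum>z = 0..<?n. if ?s x = ?t z then f z else 0)
        = (\<Sum>z = 0..<?n. if z = \<tau> (?s x) then f z else 0)"
      by (intro sum.cong refl if_cong) (simp add: t_iff sV x)
    then show ?thesis using tau_lt[OF sV[OF x]] by simp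
  qed
  have s_sum: "(\<Sum>x = 0..<?n. if ?s x = ?t z then f x else 0) = f (\<sigma> (?t z))"
    if z: "z < ?n" for z and f :: "nat \<Rightarrow> complex"
  proof -
    have "(\<Sum>x = 0..<?n. if ?s x = ?t z then f x else 0)
        = (\<Sum>x = 0..<?n. if x = \<sigma> (?t z) then f x else 0)"
      by (intro sum.cong refl if_cong) (metis s_iff tV z atLeastLessThan_iff)
    then show ?thesis using sigma_lt[OF tV[OF z]] by simp
  qed
  have if_mult: "(if b then 1 else 0) * c = (if b then c else 0)"
    "c * (if b then 1 else 0) = (if b then c else 0)" for b and c :: complex
    by auto
  have PQ: "?P * ?Q = 1\<^sub>m ?n"
  proof (rule eq_matI)
    fix x y assume "x < dim_row (1\<^sub>m ?n)" "y < dim_col (1\<^sub>m ?n)"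
    then have xy: "x < ?n" "y < ?n" by auto
    have "?s y = ?s x \<longleftrightarrow> x = y"
      using s xy by (auto simp: bij_betw_def inj_on_def)
    then show "(?P * ?Q) $$ (x, y) = 1\<^sub>m ?n $$ (x, y)"
      using xy t_eq[OF sV[OF xy(1)]]
      by (simp add: scalar_prod_def if_mult(1) t_sum[OF xy(1)])
  qed auto
  have QP: "?Q * ?P = 1\<^sub>m ?n"
  proof (rule eq_matI)
    fix x y assume "x < dim_row (1\<^sub>m ?n)" "y < dim_col (1\<^sub>m ?n)"
    then have xy: "x < ?n" "y < ?n" by auto
    have "?t x = ?t y \<longleftrightarrow> x = y"
      using t xy by (auto simp: bij_betw_def inj_on_def)
    then show "(?Q * ?P) $$ (x, y) = 1\<^sub>m ?n $$ (x, y)"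
      using xy s_eq[OF tV[OF xy(1)]]
      by (simp add: scalar_prod_def if_mult(1) s_sum[OF xy(1)])
  qed auto
  have PA: "?P * adjacency_mat G \<tau> = mat ?n ?n (\<lambda>(x, z). if (?s x, ?t z) \<in> parcs G then 1 else 0)"
    (is "_ = ?M")
  proof (rule eq_matI)
    fix x y assume "x < dim_row ?M" "y < dim_col ?M"
    then have xy: "x < ?n" "y < ?n" by auto
    show "(?P * adjacency_mat G \<tau>) $$ (x, y) = ?M $$ (x, y)"
      using xy t_eq[OF sV[OF xy(1)]] tau_lt[OF sV[OF xy(1)]]
      by (simp add: adjacency_mat_def scalar_prod_def if_mult(1) t_sum[OF xy(1)])
  qed (auto simp: adjacency_mat_def)
  have "adjacency_mat G \<sigma> = ?P * adjacency_mat G \<tau> * ?Q"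
    unfolding PA
  proof (rule eq_matI)
    fix x y assume "x < dim_row (?M * ?Q)" "y < dim_col (?M * ?Q)"
    then have xy: "x < ?n" "y < ?n" by auto
    show "adjacency_mat G \<sigma> $$ (x, y) = (?M * ?Q) $$ (x, y)"
      using xy t_eq[OF sV[OF xy(2)]] tau_lt[OF sV[OF xy(2)]]
      by (simp add: adjacency_mat_def scalar_prod_def if_mult(2) t_sum[OF xy(2)])
  qed (auto simp: adjacency_mat_def)
  with PQ QP show ?thesis
    by (intro similar_matI[where n = ?n and P = ?P and Q = ?Q]) (auto simp: adjacency_mat_carrier)
qed

lemma graph_energy_eq:
  assumes "labeling G \<sigma>"
  shows "graph_energy G = mat_energy (adjacency_mat G \<sigma>)"
proof -
  have "labeling G (SOME \<sigma>. labeling G \<sigma>)" using someI[of "labeling G" \<sigma>] assms by simp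
  then have "char_poly (adjacency_mat G (SOME \<sigma>. labeling G \<sigma>)) = char_poly (adjacency_mat G \<sigma>)"
    using assms by (intro char_poly_similar adjacency_mat_similar)
  then show ?thesis
    unfolding graph_energy_def mat_energy_def spectrum_root_char_poly[OF adjacency_mat_carrier] by simp
qed

end

theory Submission
  imports Defs
begin

text \<open>
  Schur triangularization gives, for every square complex matrix \<open>A\<close>, a unitary \<open>W\<close> with
  \<open>tr (W A) = \<E>(A)\<close>, the sum of the moduli of the eigenvalues.  Put \<open>C = F A F\<close> and
  \<open>U = F\<^sup>* W F\<^sup>*\<close>; then \<open>tr (U C) = tr (W A)\<close>.  As the entries of a unitary matrix have modulus at
  most 1, \<open>\<E>(A) = tr (U C) \<le> \<Sum> \<bar>C\<^sub>i\<^sub>j\<bar>\<close>, and equality, which is the hypothesis for a minimizing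
  labeling, forces \<open>\<bar>U\<^sub>j\<^sub>i\<bar> = 1\<close> whenever \<open>C\<^sub>i\<^sub>j \<noteq> 0\<close>.  Here \<open>C\<^sub>0\<^sub>0 = 2s/N \<noteq> 0\<close>, so \<open>\<bar>U\<^sub>0\<^sub>0\<bar> = 1\<close> already
  exhausts the unit column 0 of \<open>U\<close> and all other entries in row 0 of \<open>C\<close> vanish.  Comparing row 0
  in \<open>C F\<^sup>* = F A\<close>, all column sums of \<open>A\<close>, i.e. all degrees, coincide.
\<close>

section \<open>Adjoints, traces and unitary matrices\<close>

lemma index_mat_adjoint:
  fixes A :: "complex mat"
  assumes "i < dim_col A" "j < dim_row A"
  shows "mat_adjoint A $$ (i, j) = cnj (A $$ (j, i))"
  using assms by (simp add: mat_adjoint_def mat_of_rows_def)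

lemma dim_mat_adjoint [simp]:
  "dim_row (mat_adjoint A) = dim_col A" "dim_col (mat_adjoint A) = dim_row A"
  by (simp_all add: mat_adjoint_def mat_of_rows_def)

lemma mat_adjoint_carrier [simp]:
  "A \<in> carrier_mat m n \<Longrightarrow> mat_adjoint A \<in> carrier_mat n m"
  by (metis carrier_matD carrier_matI dim_mat_adjoint)

lemma mat_adjoint_adjoint [simp]: "mat_adjoint (mat_adjoint (A :: complex mat)) = A"
  by (rule eq_matI) (auto simp: index_mat_adjoint)

lemma index_mult_mat_sum:
  assumes "A \<in> carrier_mat m k" "B \<in> carrier_mat k n" "i < m" "j < n"
  shows "(A * B) $$ (i, j) = (\<Sum>l<k. A $$ (i, l) * B $$ (l, j))"
  using assms by (simp add: scalar_prod_def atLeast0LessThan)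

lemma mat_adjoint_mult:
  fixes A B :: "complex mat"
  assumes A: "A \<in> carrier_mat m k" and B: "B \<in> carrier_mat k n"
  shows "mat_adjoint (A * B) = mat_adjoint B * mat_adjoint A"
proof (rule eq_matI)
  fix i j assume "i < dim_row (mat_adjoint B * mat_adjoint A)" "j < dim_col (mat_adjoint B * mat_adjoint A)"
  then have ij: "i < n" "j < m" using A B by auto
  have "mat_adjoint (A * B) $$ (i, j) = cnj ((A * B) $$ (j, i))"
    using A B ij by (intro index_mat_adjoint) auto
  also have "\<dots> = (\<Sum>l<k. mat_adjoint B $$ (i, l) * mat_adjoint A $$ (l, j))"
    unfolding index_mult_mat_sum[OF A B ij(2,1)] cnj_sum
    using A B ij by (intro sum.cong) (auto simp: index_mat_adjoint)
  also have "\<dots> = (mat_adjoint B * mat_adjoint A) $$ (i, j)"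
    using A B ij by (subst index_mult_mat_sum[of _ n k _ m]) auto
  finally show "mat_adjoint (A * B) $$ (i, j) = (mat_adjoint B * mat_adjoint A) $$ (i, j)" .
qed (use A B in auto)

definition mat_trace :: "complex mat \<Rightarrow> complex" where
  "mat_trace A = (\<Sum>i<dim_row A. A $$ (i, i))"

lemma mat_trace_mult:
  assumes A: "A \<in> carrier_mat m n" and B: "B \<in> carrier_mat n m"
  shows "mat_trace (A * B) = (\<Sum>i<m. \<Sum>j<n. A $$ (i, j) * B $$ (j, i))"
  unfolding mat_trace_def
  using A B by (intro sum.cong index_mult_mat_sum) auto

lemma mat_trace_comm:
  assumes A: "A \<in> carrier_mat m n" and B: "B \<in> carrier_mat n m"
  shows "mat_trace (A * B) = mat_trace (B * A)"
  unfolding mat_trace_mult[OF A B] mat_trace_mult[OF B A]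
  by (subst sum.swap) (simp add: mult.commute)

definition unitary_mat :: "nat \<Rightarrow> complex mat \<Rightarrow> bool" where
  "unitary_mat n U \<longleftrightarrow> U \<in> carrier_mat n n \<and> mat_adjoint U * U = 1\<^sub>m n"

text \<open>A left inverse of a square matrix over a field is also a right inverse, which gives the
  third fact.\<close>

lemma unitary_matD:
  assumes "unitary_mat n U"
  shows "U \<in> carrier_mat n n" "mat_adjoint U * U = 1\<^sub>m n" "U * mat_adjoint U = 1\<^sub>m n"
  using assms mat_mult_left_right_inverse[of "mat_adjoint U" n U]
  by (auto simp: unitary_mat_def)

lemma unitary_mat_adjoint:
  assumes "unitary_mat n U"
  shows "unitary_mat n (mat_adjoint U)"
  using unitary_matD[OF assms] by (simp add: unitary_mat_def)

text \<open>Cancels an inverse pair in the middle of a product, with the bracketing that arises when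
  a product is multiplied by its own adjoint.\<close>

lemma mult_cancel_inverse_mat:
  fixes U V A B :: "'a :: comm_ring_1 mat"
  assumes "A \<in> carrier_mat m n" "U \<in> carrier_mat n n" "V \<in> carrier_mat n n" "B \<in> carrier_mat n k"
    and "U * V = 1\<^sub>m n"
  shows "A * U * (V * B) = A * B"
proof -
  have "A * U * (V * B) = A * (U * (V * B))"
    using assms by (intro assoc_mult_mat) auto
  also have "U * (V * B) = (U * V) * B"
    using assms by (intro assoc_mult_mat[symmetric]) auto
  finally show ?thesis using assms by simp
qed

lemma unitary_mat_mult:
  assumes U: "unitary_mat n U" and V: "unitary_mat n V"
  shows "unitary_mat n (U * V)"
proof -
  note cU = unitary_matD(1)[OF U] and cV = unitary_matD(1)[OF V]
  have "mat_adjoint (U * V) * (U * V) = mat_adjoint V * mat_adjoint U * (U * V)"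
    using mat_adjoint_mult[OF cU cV] by simp
  also have "\<dots> = mat_adjoint V * V"
    using cU cV unitary_matD[OF U] by (intro mult_cancel_inverse_mat) auto
  finally show ?thesis
    using cU cV unitary_matD[OF V] by (auto simp: unitary_mat_def)
qed

lemma unitary_mat_col_norm:
  assumes U: "unitary_mat n U" and j: "j < n"
  shows "(\<Sum>i<n. (cmod (U $$ (i, j)))\<^sup>2) = 1"
proof -
  note cU = unitary_matD(1)[OF U]
  have "complex_of_real (\<Sum>i<n. (cmod (U $$ (i, j)))\<^sup>2) = (\<Sum>i<n. mat_adjoint U $$ (j, i) * U $$ (i, j))"
    using cU j
    by (auto simp: index_mat_adjoint complex_norm_square mult.commute simp del: of_real_power
        intro!: sum.cong)
  also have "\<dots> = (mat_adjoint U * U) $$ (j, j)"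
    using cU j by (intro index_mult_mat_sum[symmetric]) auto
  also have "\<dots> = 1" using unitary_matD[OF U] j by simp
  finally show ?thesis by (metis of_real_eq_1_iff)
qed

text \<open>The squared modulus is one summand of the squared norm of a unit column.\<close>

lemma unitary_mat_cmod_le:
  assumes U: "unitary_mat n U" and "i < n" "j < n"
  shows "cmod (U $$ (i, j)) \<le> 1"
proof -
  have "(cmod (U $$ (i, j)))\<^sup>2 \<le> (\<Sum>i<n. (cmod (U $$ (i, j)))\<^sup>2)"
    using assms by (intro member_le_sum) auto
  then show ?thesis
    using unitary_mat_col_norm[OF U \<open>j < n\<close>] by (simp add: abs_square_le_1)
qed

section \<open>Unitary invariance of the Frobenius norm\<close>

text \<open>Expressing the squared norm as a trace reduces unitary invariance to matrix
  algebra.\<close>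

lemma frobenius_norm_trace:
  "mat_trace (mat_adjoint M * M) = complex_of_real ((frobenius_norm M)\<^sup>2)"
proof -
  have "(frobenius_norm M)\<^sup>2 = (\<Sum>i<dim_row M. \<Sum>j<dim_col M. (cmod (M $$ (i, j)))\<^sup>2)"
    unfolding frobenius_norm_def by (intro real_sqrt_pow2 sum_nonneg) auto
  also have "\<dots> = (\<Sum>j<dim_col M. \<Sum>i<dim_row M. (cmod (M $$ (i, j)))\<^sup>2)"
    by (rule sum.swap)
  also have "complex_of_real \<dots> = mat_trace (mat_adjoint M * M)"
    unfolding of_real_sum
      mat_trace_mult[OF mat_adjoint_carrier[OF carrier_matI[OF refl refl]] carrier_matI[OF refl refl], of M]
    by (intro sum.cong refl) (simp add: index_mat_adjoint complex_norm_square mult.commute del: of_real_power)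
  finally show ?thesis by simp
qed

lemma frobenius_norm_nonneg: "frobenius_norm M \<ge> 0"
  unfolding frobenius_norm_def by (intro real_sqrt_ge_zero sum_nonneg) auto

lemma frobenius_norm_eqI:
  assumes "mat_trace (mat_adjoint M * M) = mat_trace (mat_adjoint L * L)"
  shows "frobenius_norm M = frobenius_norm L"
  using assms frobenius_norm_nonneg[of M] frobenius_norm_nonneg[of L]
  unfolding frobenius_norm_trace of_real_eq_iff by (metis power2_eq_iff_nonneg)

text \<open>A left unitary factor cancels inside \<open>mat_adjoint M * M\<close>. A right one
  cancels inside \<open>M * mat_adjoint M\<close>, which has the same trace.\<close>

lemma frobenius_norm_unitary:
  assumes U: "unitary_mat n U" and V: "unitary_mat n V" and M: "M \<in> carrier_mat n n"
  shows "frobenius_norm (U * M * V) = frobenius_norm M"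
proof -
  note cU = unitary_matD(1)[OF U] and cV = unitary_matD(1)[OF V]
  have left: "frobenius_norm (U * L) = frobenius_norm L" if L: "L \<in> carrier_mat n n" for L
  proof (rule frobenius_norm_eqI)
    have "mat_adjoint (U * L) * (U * L) = mat_adjoint L * mat_adjoint U * (U * L)"
      using mat_adjoint_mult[OF cU L] by simp
    also have "\<dots> = mat_adjoint L * L"
      using cU L unitary_matD[OF U] by (intro mult_cancel_inverse_mat) auto
    finally show "mat_trace (mat_adjoint (U * L) * (U * L)) = mat_trace (mat_adjoint L * L)"
      by simp
  qed
  have right: "frobenius_norm (M * V) = frobenius_norm M"
  proof (rule frobenius_norm_eqI)
    have "mat_trace (mat_adjoint (M * V) * (M * V)) = mat_trace ((M * V) * mat_adjoint (M * V))"
      using M cV by (intro mat_trace_comm) auto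
    also have "(M * V) * mat_adjoint (M * V) = M * V * (mat_adjoint V * mat_adjoint M)"
      using mat_adjoint_mult[OF M cV] by simp
    also have "\<dots> = M * mat_adjoint M"
      using M cV unitary_matD[OF V] by (intro mult_cancel_inverse_mat) auto
    also have "mat_trace \<dots> = mat_trace (mat_adjoint M * M)"
      using M by (intro mat_trace_comm) auto
    finally show "mat_trace (mat_adjoint (M * V) * (M * V)) = mat_trace (mat_adjoint M * M)" .
  qed
  have "U * M * V = U * (M * V)" using cU cV M by (intro assoc_mult_mat) auto
  then show ?thesis using left[of "M * V"] right M cV by auto
qed

section \<open>A unitary matrix whose product with \<open>A\<close> has the energy as its
  trace\<close>

text \<open>Gram-Schmidt applied to a basis that begins with \<open>v\<close> keeps \<open>v\<close>
  as its first vector. Normalizing the resulting vectors yields the columns of \<open>V\<close>, so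
  \<open>c\<close> is the reciprocal of the length of \<open>v\<close>.\<close>

lemma unitary_completion:
  assumes v: "v \<in> carrier_vec n" and v0: "v \<noteq> 0\<^sub>v n"
  obtains V c where "unitary_mat n V" "col V 0 = c \<cdot>\<^sub>v (v :: complex vec)"
proof -
  interpret cof_vec_space n "TYPE(complex)" .
  define b where "b = basis_completion v"
  define ws where "ws = gram_schmidt n b"
  from basis_completion[OF v v0, folded b_def]
  have dist_b: "distinct b" and indep: "\<not> lin_dep (set b)" and b: "set b \<subseteq> carrier_vec n"
    and hdb: "hd b = v" and len_b: "length b = n" by auto
  have n: "n \<noteq> 0" using v v0 by auto
  from hdb len_b n obtain vs where bv: "b = v # vs" by (cases b) auto
  from gram_schmidt_result[OF b dist_b indep refl, folded ws_def]
  have ws: "set ws \<subseteq> carrier_vec n" "corthogonal ws" "length ws = n"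
    by (auto simp: len_b)
  from gram_schmidt_hd[OF v, of vs, folded bv] have "hd ws = v" unfolding ws_def .
  then have ws0: "ws ! 0 = v" using ws(3) n by (cases ws) auto
  have wsi: "ws ! i \<in> carrier_vec n" if "i < n" for i using ws that by auto
  \<comment> \<open>\<open>corthogonal\<close> gives pairwise orthogonal nonzero vectors of
    arbitrary length; \<open>r i\<close> is the Euclidean length to divide by.\<close>
  define r where "r i = sqrt (\<Sum>l<n. (cmod (ws ! i $ l))\<^sup>2)" for i
  have r_sq: "ws ! i \<bullet>c ws ! i = complex_of_real ((r i)\<^sup>2)" if "i < n" for i
  proof -
    have "(r i)\<^sup>2 = (\<Sum>l<n. (cmod (ws ! i $ l))\<^sup>2)"
      unfolding r_def by (intro real_sqrt_pow2 sum_nonneg) auto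
    then show ?thesis
      using wsi[OF that]
      by (auto simp: scalar_prod_def atLeast0LessThan complex_norm_square simp del: of_real_power
          intro!: sum.cong)
  qed
  have orth: "ws ! i \<bullet>c ws ! j = 0 \<longleftrightarrow> i \<noteq> j" if "i < n" "j < n" for i j
    using corthogonalD[OF ws(2), of i j] ws(3) that by auto
  have r0: "r i \<noteq> 0" if "i < n" for i using orth[OF that that] r_sq[OF that] by auto
  define V where "V = mat n n (\<lambda>(l, j). ws ! j $ l / r j)"
  have V: "V \<in> carrier_mat n n" by (simp add: V_def)
  have "mat_adjoint V * V = 1\<^sub>m n"
  proof (rule eq_matI)
    fix i j assume "i < dim_row (1\<^sub>m n)" "j < dim_col (1\<^sub>m n)"
    then have ij: "i < n" "j < n" by auto
    have "(mat_adjoint V * V) $$ (i, j) = (\<Sum>l<n. mat_adjoint V $$ (i, l) * V $$ (l, j))"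
      using V ij by (intro index_mult_mat_sum) auto
    also have "\<dots> = (\<Sum>l<n. ws ! j $ l * cnj (ws ! i $ l) / (r i * r j))"
      using V ij by (intro sum.cong) (auto simp: index_mat_adjoint V_def)
    also have "\<dots> = (ws ! j \<bullet>c ws ! i) / (r i * r j)"
      using wsi[OF ij(1)] wsi[OF ij(2)]
      by (auto simp: scalar_prod_def atLeast0LessThan sum_divide_distrib intro!: sum.cong)
    also have "\<dots> = 1\<^sub>m n $$ (i, j)"
      using orth[OF ij(2,1)] r_sq[OF ij(1)] r0[OF ij(1)] ij
      by (auto simp: power2_eq_square)
    finally show "(mat_adjoint V * V) $$ (i, j) = 1\<^sub>m n $$ (i, j)" .
  qed (use V in auto)
  then have "unitary_mat n V" using V by (simp add: unitary_mat_def)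
  moreover have "col V 0 = (1 / complex_of_real (r 0)) \<cdot>\<^sub>v v"
    using n v ws0 by (intro eq_vecI) (auto simp: V_def)
  ultimately show thesis by (rule that)
qed

text \<open>Extends the unitary matrix of the smaller problem by one phase \<open>s\<close>;
  blockwise, the top left entry of the product is \<open>cnj s * s = 1\<close>.\<close>

lemma unitary_mat_block:
  assumes U: "unitary_mat n U" and s: "cmod s = 1"
  shows "unitary_mat (Suc n) (four_block_mat (mat 1 1 (\<lambda>_. s)) (0\<^sub>m 1 n) (0\<^sub>m n 1) U)" (is "unitary_mat _ ?B")
proof -
  note cU = unitary_matD(1)[OF U]
  have B: "?B \<in> carrier_mat (Suc n) (Suc n)" using cU by auto
  have adj: "mat_adjoint ?B = four_block_mat (mat 1 1 (\<lambda>_. cnj s)) (0\<^sub>m 1 n) (0\<^sub>m n 1) (mat_adjoint U)"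
    using cU by (intro eq_matI) (auto simp: index_mat_adjoint)
  have "cnj s * s = 1" using s by (metis complex_norm_square mult.commute of_real_1 one_power2)
  then have "mat 1 1 (\<lambda>_. cnj s) * mat 1 1 (\<lambda>_. s) = (1\<^sub>m 1 :: complex mat)"
    by (intro eq_matI) (auto simp: scalar_prod_def)
  then have "mat_adjoint ?B * ?B = four_block_mat (1\<^sub>m 1) (0\<^sub>m 1 n) (0\<^sub>m n 1) (1\<^sub>m n)"
    unfolding adj
    by (subst mult_four_block_mat[of _ 1 1 _ n _ n _ _ 1 _ n]) (use cU unitary_matD[OF U] in auto)
  also have "\<dots> = 1\<^sub>m (Suc n)" by (intro eq_matI) auto
  finally show ?thesis using B by (simp add: unitary_mat_def)
qed

lemma mat_trace_four_block:
  assumes "A \<in> carrier_mat m m" "D \<in> carrier_mat n n"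
  shows "mat_trace (four_block_mat A B C D) = mat_trace A + mat_trace D"
proof -
  have "mat_trace (four_block_mat A B C D)
      = (\<Sum>i<m. four_block_mat A B C D $$ (i, i)) + (\<Sum>i=m..<m + n. four_block_mat A B C D $$ (i, i))"
    using assms sum.atLeastLessThan_concat[of 0 m "m + n" "\<lambda>i. four_block_mat A B C D $$ (i, i)"]
    by (simp add: mat_trace_def lessThan_atLeast0 del: index_mat_four_block(1))
  also have "(\<Sum>i=m..<m + n. four_block_mat A B C D $$ (i, i)) = (\<Sum>i<n. D $$ (i, i))"
    using assms sum.shift_bounds_nat_ivl[of "\<lambda>i. four_block_mat A B C D $$ (i, i)" 0 m n]
    by (simp add: lessThan_atLeast0 add.commute)
  also have "(\<Sum>i<m. four_block_mat A B C D $$ (i, i)) = (\<Sum>i<m. A $$ (i, i))"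
    using assms by (intro sum.cong) auto
  finally show ?thesis using assms by (simp add: mat_trace_def)
qed

text \<open>One step of Schur triangularization: if the first column of the unitary \<open>V\<close>
  is an eigenvector for \<open>e\<close>, then the first column of the conjugated matrix is
  \<open>e\<close> times the first unit vector.\<close>

lemma unitary_deflation:
  assumes A: "(A :: complex mat) \<in> carrier_mat (Suc n) (Suc n)" and e: "eigenvalue A e"
  obtains V A2 A3 where "unitary_mat (Suc n) V" "A2 \<in> carrier_mat 1 n" "A3 \<in> carrier_mat n n"
    "mat_adjoint V * A * V = four_block_mat (mat 1 1 (\<lambda>_. e)) A2 (0\<^sub>m n 1) A3"
proof -
  obtain v where v: "v \<in> carrier_vec (Suc n)" "v \<noteq> 0\<^sub>v (Suc n)" and Av: "A *\<^sub>v v = e \<cdot>\<^sub>v v"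
    using e A unfolding eigenvalue_def eigenvector_def by auto
  obtain V c where V: "unitary_mat (Suc n) V" and V0: "col V 0 = c \<cdot>\<^sub>v v"
    using unitary_completion[OF v] .
  note cV = unitary_matD(1)[OF V]
  define B where "B = mat_adjoint V * A * V"
  have B: "B \<in> carrier_mat (Suc n) (Suc n)"
    unfolding B_def using cV A by (metis mat_adjoint_carrier mult_carrier_mat)
  have AV0: "A *\<^sub>v col V 0 = e \<cdot>\<^sub>v col V 0"
    unfolding V0 using A v by (simp add: mult_mat_vec Av smult_smult_assoc mult.commute)
  \<comment> \<open>The first column of \<open>V\<close> is the image of the first unit vector under
    \<open>V\<close>, and the adjoint inverts \<open>V\<close>.\<close>
  have VV0: "mat_adjoint V *\<^sub>v col V 0 = unit_vec (Suc n) 0"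
  proof -
    have "mat_adjoint V *\<^sub>v col V 0 = col (mat_adjoint V * V) 0"
      using cV by (intro eq_vecI) auto
    then show ?thesis using unitary_matD[OF V] by simp
  qed
  have "col B 0 = mat_adjoint V *\<^sub>v (A *\<^sub>v col V 0)"
  proof -
    have "B = mat_adjoint V * (A * V)"
      unfolding B_def using cV A by (intro assoc_mult_mat) auto
    then show ?thesis using cV A by (intro eq_vecI) (auto simp: mult_mat_vec_def)
  qed
  also have "\<dots> = e \<cdot>\<^sub>v unit_vec (Suc n) 0"
    unfolding AV0 using cV VV0 mult_mat_vec[of "mat_adjoint V" "Suc n" "Suc n" "col V 0" e]
    by (metis col_dim carrier_matD(1) mat_adjoint_carrier)
  finally have B0: "col B 0 = e \<cdot>\<^sub>v unit_vec (Suc n) 0" .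
  have B0_entry: "B $$ (i, 0) = (if i = 0 then e else 0)" if "i < Suc n" for i
    using arg_cong[OF B0, of "\<lambda>w. w $ i"] B that by auto
  let ?A2 = "mat 1 n (\<lambda>(i, j). B $$ (0, Suc j))" and ?A3 = "mat n n (\<lambda>(i, j). B $$ (Suc i, Suc j))"
  have "B = four_block_mat (mat 1 1 (\<lambda>_. e)) ?A2 (0\<^sub>m n 1) ?A3"
    using B B0_entry by (intro eq_matI) auto
  then show thesis using that[OF V, of ?A2 ?A3] unfolding B_def by simp
qed

lemma similar_mat_unitary:
  assumes V: "unitary_mat n V" and A: "A \<in> carrier_mat n n"
  shows "similar_mat (mat_adjoint V * A * V) A"
proof -
  note cV = unitary_matD(1)[OF V]
  have "mat_adjoint V * A * V \<in> carrier_mat n n"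
    using cV A by (metis mat_adjoint_carrier mult_carrier_mat)
  then show ?thesis
    using cV A unitary_matD[OF V]
    by (intro similar_matI[where n = n and P = "mat_adjoint V" and Q = V]) auto
qed

text \<open>Cyclicity of the trace moves outer factors from \<open>U\<close> to \<open>A\<close>.
  \<open>P\<close> and \<open>Q\<close> are independent, so this covers both conjugation by a
  unitary matrix and multiplication by the adjoint Fourier matrix on both sides.\<close>

lemma mat_trace_conj:
  assumes "U \<in> carrier_mat n n" "P \<in> carrier_mat n n" "Q \<in> carrier_mat n n" "A \<in> carrier_mat n n"
  shows "mat_trace (P * U * Q * A) = mat_trace (U * (Q * A * P))"
proof -
  have "P * U * Q * A = P * (U * (Q * A))"
    using assms by (simp add: assoc_mult_mat[of _ n n _ n _ n])
  also have "mat_trace \<dots> = mat_trace (U * (Q * A) * P)"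
    using assms by (intro mat_trace_comm) auto
  also have "U * (Q * A) * P = U * (Q * A * P)"
    using assms by (simp add: assoc_mult_mat[of _ n n _ n _ n])
  finally show ?thesis .
qed

text \<open>Deflation removes one eigenvalue \<open>e\<close> and leaves a block \<open>A3\<close>
  with the others. If \<open>s\<close> rotates \<open>e\<close> to its modulus and \<open>U\<close>
  serves \<open>A3\<close>, the block diagonal matrix of \<open>s\<close> and \<open>U\<close>,
  conjugated back by \<open>V\<close>, serves \<open>A\<close>; the off-diagonal block
  \<open>A2\<close> does not reach the trace.\<close>

lemma exists_unitary_trace_eigenvalues:
  assumes "A \<in> carrier_mat n n" "char_poly A = (\<Prod>e\<leftarrow>es. [:- e, 1:])"
  shows "\<exists>U. unitary_mat n U \<and> mat_trace (U * A) = complex_of_real (\<Sum>e\<leftarrow>es. cmod e)"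
  using assms
proof (induction es arbitrary: n A)
  case Nil
  then have "n = 0" using degree_monic_char_poly[of A n] by simp
  then have "unitary_mat n (1\<^sub>m n)" by (auto simp: unitary_mat_def)
  then show ?case using \<open>n = 0\<close> by (intro exI[of _ "1\<^sub>m n"]) (auto simp: mat_trace_def)
next
  case (Cons e es)
  note A = Cons.prems(1)
  \<comment> \<open>A nonempty list of roots forces a positive dimension, so a row and a column can
    be split off.\<close>
  have "degree (\<Prod>e\<leftarrow>es. [:- e, 1:]) + 1 = n"
  proof -
    have "monic (\<Prod>e\<leftarrow>es. [:- e, 1:])" by (rule monic_prod_list) auto
    then have "degree ([:- e, 1:] * (\<Prod>e\<leftarrow>es. [:- e, 1:])) = 1 + degree (\<Prod>e\<leftarrow>es. [:- e, 1:])"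
      by (subst degree_mult_eq) auto
    then show ?thesis using degree_monic_char_poly[OF A] Cons.prems(2) by simp
  qed
  then obtain m where n: "n = Suc m" by auto
  have "eigenvalue A e"
    unfolding eigenvalue_root_char_poly[OF A] Cons.prems(2) by simp
  then obtain V A2 A3 where V: "unitary_mat n V" and A2: "A2 \<in> carrier_mat 1 m"
    and A3: "A3 \<in> carrier_mat m m"
    and B: "mat_adjoint V * A * V = four_block_mat (mat 1 1 (\<lambda>_. e)) A2 (0\<^sub>m m 1) A3"
    using unitary_deflation[OF A[unfolded n]] unfolding n by metis
  note cV = unitary_matD(1)[OF V]
  have "char_poly (mat_adjoint V * A * V) = [:- e, 1:] * (\<Prod>e\<leftarrow>es. [:- e, 1:])"
    using char_poly_similar[OF similar_mat_unitary[OF V A]] Cons.prems(2) by simp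
  moreover have "char_poly (mat_adjoint V * A * V) = char_poly (mat 1 1 (\<lambda>_. e)) * char_poly A3"
    unfolding B by (rule char_poly_four_block_zeros_col[OF _ A2 A3]) simp
  moreover have "char_poly (mat 1 1 (\<lambda>_. e)) = [:- e, 1:]"
    by (simp add: char_poly_defs det_def sign_def)
  ultimately have "char_poly A3 = (\<Prod>e\<leftarrow>es. [:- e, 1:])"
    by (metis mult_cancel_left pCons_eq_0_iff zero_neq_one)
  then obtain U where U: "unitary_mat m U"
    and tr: "mat_trace (U * A3) = complex_of_real (\<Sum>e\<leftarrow>es. cmod e)"
    using Cons.IH[OF A3] by blast
  note cU = unitary_matD(1)[OF U]
  \<comment> \<open>The phase that turns \<open>e\<close> into its modulus. At \<open>e = 0\<close>
    the quotient would be 0, so the value 1 keeps \<open>s\<close> unimodular.\<close>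
  define s where "s = (if e = 0 then 1 else cnj e / cmod e)"
  have s: "cmod s = 1" by (simp add: s_def norm_divide)
  have se: "s * e = cmod e"
  proof (cases "e = 0")
    case False
    have "cnj e * e = complex_of_real (cmod e) * complex_of_real (cmod e)"
      using complex_norm_square[of e] by (simp add: power2_eq_square mult.commute)
    then show ?thesis using False by (simp add: s_def)
  qed (simp add: s_def)
  define W where "W = four_block_mat (mat 1 1 (\<lambda>_. s)) (0\<^sub>m 1 m) (0\<^sub>m m 1) U"
  have W: "unitary_mat n W" unfolding W_def n by (rule unitary_mat_block[OF U s])
  note cW = unitary_matD(1)[OF W]
  have "mat_trace (V * W * mat_adjoint V * A) = mat_trace (W * (mat_adjoint V * A * V))"
    using cV cW A by (intro mat_trace_conj) auto
  also have "W * (mat_adjoint V * A * V)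
      = four_block_mat (mat 1 1 (\<lambda>_. s) * mat 1 1 (\<lambda>_. e)) (mat 1 1 (\<lambda>_. s) * A2) (0\<^sub>m m 1) (U * A3)"
    unfolding B W_def
    by (subst mult_four_block_mat[of _ 1 1 _ m _ m _ _ 1 _ m]) (use cU A2 A3 in auto)
  also have "mat_trace \<dots> = mat_trace (mat 1 1 (\<lambda>_. s) * mat 1 1 (\<lambda>_. e)) + mat_trace (U * A3)"
    using cU A3 by (intro mat_trace_four_block) auto
  also have "mat_trace (mat 1 1 (\<lambda>_. s) * mat 1 1 (\<lambda>_. e)) = s * e"
    by (simp add: mat_trace_def scalar_prod_def)
  finally have "mat_trace (V * W * mat_adjoint V * A) = complex_of_real (\<Sum>e\<leftarrow>e # es. cmod e)"
    using se tr by simp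
  moreover have "unitary_mat n (V * W * mat_adjoint V)"
    by (intro unitary_mat_mult unitary_mat_adjoint V W)
  ultimately show ?case by blast
qed

section \<open>The energy as a sum over the list of eigenvalues\<close>

text \<open>Orders add over products, and a monic linear factor has order 1 at its own root and 0
  elsewhere. Algebraic multiplicities thus become multiplicities in the list of roots.\<close>

lemma order_prod_list_linear:
  "Polynomial.order k (\<Prod>e\<leftarrow>es. [:- e, 1:]) = count_list es (k :: 'a :: field)"
proof (induction es)
  case (Cons e es)
  have "monic (\<Prod>e\<leftarrow>es. [:- e, 1:])" by (rule monic_prod_list) auto
  then have "(\<Prod>e\<leftarrow>es. [:- e, 1:]) \<noteq> 0" by auto
  then have "[:- e, 1:] * (\<Prod>e\<leftarrow>es. [:- e, 1:]) \<noteq> 0" by (simp del: mult_pCons_left)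
  then have "Polynomial.order k ([:- e, 1:] * (\<Prod>e\<leftarrow>es. [:- e, 1:]))
      = Polynomial.order k [:- e, 1:] + count_list es k"
    by (simp add: order_mult Cons.IH del: mult_pCons_left)
  moreover have "Polynomial.order k [:- e, 1:] = (if e = k then 1 else 0)"
    using order_linear_power[of k "- e" 1] by simp
  ultimately show ?case by simp
qed simp

text \<open>The fixed superset \<open>S\<close> keeps the index set unchanged during the induction
  on \<open>xs\<close>.\<close>

lemma sum_list_map_eq_sum_count_superset:
  fixes f :: "'a \<Rightarrow> 'b :: comm_semiring_1"
  assumes "finite S" "set xs \<subseteq> S"
  shows "(\<Sum>x\<leftarrow>xs. f x) = (\<Sum>x\<in>S. of_nat (count_list xs x) * f x)"
  using assms(2)
proof (induction xs)
  case (Cons y xs)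
  have "(\<Sum>x\<in>S. of_nat (count_list (y # xs) x) * f x)
      = (\<Sum>x\<in>S. of_nat (count_list xs x) * f x + (if x = y then f x else 0))"
    by (intro sum.cong) (auto simp: algebra_simps)
  then show ?case
    using Cons assms(1) by (simp add: sum.distrib add.commute)
qed simp

lemma mat_energy_eq_sum_list:
  assumes A: "A \<in> carrier_mat n n" and c: "char_poly A = (\<Prod>e\<leftarrow>es. [:- e, 1:])"
  shows "mat_energy A = (\<Sum>e\<leftarrow>es. cmod e)"
proof -
  have "spectrum A = set es"
    unfolding spectrum_root_char_poly[OF A] c
    by (auto simp: poly_prod_list prod_list_zero_iff)
  then show ?thesis
    unfolding mat_energy_def c order_prod_list_linear
    by (simp add: sum_list_map_eq_sum_count_superset[OF finite_set subset_refl])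
qed

text \<open>The characteristic polynomial splits over the complex numbers, so a list of roots exists
  for both preceding results.\<close>

lemma exists_unitary_trace_energy:
  assumes A: "A \<in> carrier_mat n n"
  obtains U where "unitary_mat n U" "mat_trace (U * A) = complex_of_real (mat_energy A)"
  using char_poly_factorized[OF A] exists_unitary_trace_eigenvalues[OF A] mat_energy_eq_sum_list[OF A]
  by metis

section \<open>The equality case of the trace bound\<close>

text \<open>The real part of each summand of the trace is at most the modulus of the entry of
  \<open>B\<close>, because entries of \<open>U\<close> have modulus at most 1. Equality of the two
  sums forces equality in every summand.\<close>

lemma unitary_trace_l1_extremal:
  assumes B: "B \<in> carrier_mat n n" and U: "unitary_mat n U"
    and tr: "mat_trace (U * B) = complex_of_real (entrywise_l1_norm B)"
    and ij: "i < n" "j < n" and nz: "B $$ (i, j) \<noteq> 0"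
  shows "cmod (U $$ (j, i)) = 1"
proof -
  note cU = unitary_matD(1)[OF U]
  define f where "f p = Re (U $$ (snd p, fst p) * B $$ p)" for p
  define g where "g p = cmod (B $$ p)" for p
  have fg: "f p \<le> cmod (U $$ (snd p, fst p)) * g p" for p
    unfolding f_def g_def by (metis complex_Re_le_cmod norm_mult)
  have le: "f p \<le> g p" if "p \<in> {..<n} \<times> {..<n}" for p
  proof -
    have "cmod (U $$ (snd p, fst p)) * g p \<le> 1 * g p"
      using that unitary_mat_cmod_le[OF U] by (intro mult_right_mono) (auto simp: g_def)
    then show ?thesis using fg[of p] by simp
  qed
  have "Re (mat_trace (U * B)) = (\<Sum>p\<in>{..<n} \<times> {..<n}. f p)"
    unfolding mat_trace_mult[OF cU B]
    by (subst sum.swap) (simp add: sum.cartesian_product f_def case_prod_unfold)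
  moreover have "entrywise_l1_norm B = (\<Sum>p\<in>{..<n} \<times> {..<n}. g p)"
    using B by (simp add: entrywise_l1_norm_def sum.cartesian_product g_def case_prod_unfold)
  ultimately have "sum f ({..<n} \<times> {..<n}) = sum g ({..<n} \<times> {..<n})" using tr by simp
  then have "f (i, j) = g (i, j)"
    using sum_mono_inv[of f "{..<n} \<times> {..<n}" g "(i, j)"] le ij by auto
  \<comment> \<open>With \<open>f = g\<close> at this index, the bound \<open>fg\<close> can be
    divided by the positive number \<open>g (i, j)\<close>.\<close>
  then have "1 * g (i, j) \<le> cmod (U $$ (j, i)) * g (i, j)" using fg[of "(i, j)"] by simp
  moreover have "g (i, j) > 0" using nz by (simp add: g_def)
  ultimately have "1 \<le> cmod (U $$ (j, i))" by (simp only: mult_le_cancel_right_pos)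
  then show ?thesis using unitary_mat_cmod_le[OF U ij(2,1)] by simp
qed

text \<open>Two different unimodular entries would give a unit column squared norm at least
  2.\<close>

lemma unitary_mat_col_single:
  assumes U: "unitary_mat n U" and "i < n" "k < n" "j < n"
    and "cmod (U $$ (i, j)) = 1" "cmod (U $$ (k, j)) = 1"
  shows "i = k"
proof (rule ccontr)
  assume "i \<noteq> k"
  have "(\<Sum>l\<in>{i, k}. (cmod (U $$ (l, j)))\<^sup>2) \<le> (\<Sum>l<n. (cmod (U $$ (l, j)))\<^sup>2)"
    using assms by (intro sum_mono2) auto
  then show False
    using \<open>i \<noteq> k\<close> assms unitary_mat_col_norm[OF U \<open>j < n\<close>] by simp
qed

section \<open>Unitarity of the Fourier matrix\<close>

text \<open>A geometric sum whose ratio is an \<open>N\<close>-th root of unity: it vanishes unless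
  the ratio is 1, and distinct indices below \<open>N\<close> give distinct roots.\<close>

lemma sum_powers_roots_of_unity:
  assumes j: "j < N" and k: "k < N"
  shows "(\<Sum>x<N. (cis (2 * pi * real j / real N) * cnj (cis (2 * pi * real k / real N))) ^ x)
    = (if j = k then of_nat N else 0)"
proof -
  let ?w = "\<lambda>j. cis (2 * pi * real j / real N)"
  have bij: "bij_betw ?w {..<N} {z. z ^ N = 1}" using j by (intro bij_betw_roots_unity) simp
  have cnj_w: "cnj (?w k) * ?w k = 1" by (simp add: cis_cnj cis_mult)
  show ?thesis
  proof (cases "j = k")
    case True
    then show ?thesis using cnj_w by (simp add: mult.commute)
  next
    case False
    have w_N: "?w j ^ N = 1" "?w k ^ N = 1" using bij j k by (auto simp: bij_betw_def)
    have z_N: "(?w j * cnj (?w k)) ^ N = 1"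
      unfolding power_mult_distrib complex_cnj_power[symmetric] w_N by simp
    have "?w j * cnj (?w k) \<noteq> 1"
    proof
      assume "?w j * cnj (?w k) = 1"
      then have "?w j = ?w k"
        using cnj_w by (metis mult.assoc mult.right_neutral mult.left_neutral)
      then show False using bij j k False by (auto simp: bij_betw_def inj_on_def)
    qed
    from geometric_sum[OF this, of N] show ?thesis unfolding z_N using False by simp
  qed
qed

lemma fourier_mat_carrier: "fourier_mat N \<in> carrier_mat N N"
  by (simp add: fourier_mat_def)

text \<open>Writing an entry as a power with the row index as exponent turns inner products of
  columns into geometric sums.\<close>

lemma fourier_mat_entry:
  assumes "x < N" "k < N"
  shows "fourier_mat N $$ (x, k) = cnj (cis (2 * pi * real k / real N)) ^ x / of_real (sqrt (real N))"
proof -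
  have "cnj (cis (2 * pi * real k / real N)) ^ x = cis (real x * (- (2 * pi * real k / real N)))"
    by (simp only: cis_cnj DeMoivre)
  also have "\<dots> = exp (- 2 * of_real pi * \<i> * of_nat x * of_nat k / of_nat N)"
    unfolding cis_conv_exp by (rule arg_cong[of _ _ exp]) (simp add: mult_ac)
  finally show ?thesis using assms by (simp add: fourier_mat_def)
qed

lemma fourier_mat_row_0: "x < N \<Longrightarrow> fourier_mat N $$ (0, x) = 1 / of_real (sqrt (real N))"
  and fourier_mat_col_0: "x < N \<Longrightarrow> fourier_mat N $$ (x, 0) = 1 / of_real (sqrt (real N))"
  by (simp_all add: fourier_mat_def)

lemma unitary_fourier_mat: "unitary_mat N (fourier_mat N)"
proof -
  let ?F = "fourier_mat N"
  note cF = fourier_mat_carrier[of N]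
  have "mat_adjoint ?F * ?F = 1\<^sub>m N"
  proof (rule eq_matI)
    fix j k assume "j < dim_row (1\<^sub>m N)" "k < dim_col (1\<^sub>m N)"
    then have jk: "j < N" "k < N" by auto
    have sq: "complex_of_real (sqrt (real N)) * complex_of_real (sqrt (real N)) = of_nat N"
      by (simp flip: of_real_mult)
    have "(mat_adjoint ?F * ?F) $$ (j, k) = (\<Sum>x<N. mat_adjoint ?F $$ (j, x) * ?F $$ (x, k))"
      using cF jk by (intro index_mult_mat_sum) auto
    also have "\<dots> = (\<Sum>x<N. (cis (2 * pi * real j / real N) * cnj (cis (2 * pi * real k / real N))) ^ x / of_nat N)"
      using cF jk sq by (intro sum.cong refl) (simp add: index_mat_adjoint fourier_mat_entry power_mult_distrib)
    also have "\<dots> = 1\<^sub>m N $$ (j, k)"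
      unfolding sum_divide_distrib[symmetric] sum_powers_roots_of_unity[OF jk] using jk by simp
    finally show "(mat_adjoint ?F * ?F) $$ (j, k) = 1\<^sub>m N $$ (j, k)" .
  qed (use cF in auto)
  then show ?thesis using cF by (simp add: unitary_mat_def)
qed

section \<open>Entry sums of the adjacency matrix\<close>

text \<open>Forgetting orientation maps the arcs onto the edges. Every fibre is
  \<open>{(u, v), (v, u)}\<close>, which has two elements as there are no loops.\<close>

lemma card_parcs_eq_twice_graph_size:
  assumes "pair_graph G"
  shows "card (parcs G) = 2 * graph_size G"
proof -
  interpret pair_graph G by fact
  define ends :: "'a \<times> 'a \<Rightarrow> 'a set" where "ends a = {fst a, snd a}" for a
  have edges: "graph_edges G = ends ` parcs G"
    by (force simp: graph_edges_def ends_def)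
  have fin: "finite (parcs G)" by (rule pair_finite_arcs)
  have fibre: "card {a \<in> parcs G. ends a = E} = 2" if E: "E \<in> graph_edges G" for E
  proof -
    obtain a where a: "a \<in> parcs G" "E = ends a" using E unfolding edges by blast
    define u v where "u = fst a" and "v = snd a"
    have uv: "(u, v) \<in> parcs G" using a(1) by (simp add: u_def v_def)
    have vu: "(v, u) \<in> parcs G" by (rule arcs_symmetric[OF uv])
    have "ends b = E \<longleftrightarrow> b = (u, v) \<or> b = (v, u)" for b
      unfolding a(2) ends_def u_def[symmetric] v_def[symmetric]
      by (cases b) (simp add: doubleton_eq_iff)
    then have "{a \<in> parcs G. ends a = E} = {a \<in> parcs G. a = (u, v) \<or> a = (v, u)}"
      by (simp only:)
    also have "\<dots> = {(u, v), (v, u)}" using uv vu by auto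
    finally show ?thesis using pair_no_loops[OF uv] by simp
  qed
  have "card (parcs G) = (\<Sum>E\<in>graph_edges G. card {a \<in> parcs G. ends a = E})"
    unfolding edges
    using sum.group[OF fin finite_imageI[OF fin, of ends] subset_refl, of "\<lambda>_. 1 :: nat"] by simp
  then show ?thesis by (simp add: fibre graph_size_def)
qed

lemma labeling_sum:
  assumes "labeling G \<sigma>"
  shows "(\<Sum>x<graph_order G. f (inv_into (pverts G) \<sigma> x)) = (\<Sum>v\<in>pverts G. f v)"
  using assms unfolding labeling_def atLeast0LessThan
  by (intro sum.reindex_bij_betw bij_betw_inv_into)

lemma adjacency_mat_col_sum:
  assumes G: "pair_graph G" and \<sigma>: "labeling G \<sigma>" and v: "v \<in> pverts G"
  shows "(\<Sum>x<graph_order G. adjacency_mat G \<sigma> $$ (x, \<sigma> v)) = of_nat (degree_of G v)"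
proof -
  interpret pair_graph G by fact
  have "\<sigma> v < graph_order G" using \<sigma> v by (auto simp: labeling_def bij_betw_def)
  then have "(\<Sum>x<graph_order G. adjacency_mat G \<sigma> $$ (x, \<sigma> v))
      = (\<Sum>x<graph_order G. if (inv_into (pverts G) \<sigma> x, v) \<in> parcs G then 1 else 0)"
    using \<sigma> v by (intro sum.cong) (auto simp: adjacency_mat_def labeling_def bij_betw_inv_into_left)
  also have "\<dots> = (\<Sum>u\<in>pverts G. if (u, v) \<in> parcs G then 1 else 0)"
    by (rule labeling_sum[OF \<sigma>])
  also have "\<dots> = of_nat (card {u \<in> pverts G. (u, v) \<in> parcs G})"
    using pair_finite_verts by (simp add: sum.If_cases Int_def)
  \<comment> \<open>Column sums count arcs into \<open>v\<close>, whereas \<open>degree_of\<close>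
    counts arcs out of \<open>v\<close>; symmetry identifies them.\<close>
  also have "{u \<in> pverts G. (u, v) \<in> parcs G} = {u. (v, u) \<in> parcs G}"
    using arcs_symmetric in_arcsD1 by blast
  finally show ?thesis by (simp add: degree_of_def)
qed

lemma adjacency_mat_sum:
  assumes G: "pair_graph G" and \<sigma>: "labeling G \<sigma>"
  shows "(\<Sum>x<graph_order G. \<Sum>y<graph_order G. adjacency_mat G \<sigma> $$ (x, y)) = of_nat (2 * graph_size G)"
proof -
  interpret pair_graph G by fact
  have "(\<Sum>x<graph_order G. \<Sum>y<graph_order G. adjacency_mat G \<sigma> $$ (x, y))
      = (\<Sum>x<graph_order G. \<Sum>y<graph_order G.
          if (inv_into (pverts G) \<sigma> x, inv_into (pverts G) \<sigma> y) \<in> parcs G then 1 else 0)"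
    by (intro sum.cong) (auto simp: adjacency_mat_def)
  also have "\<dots> = (\<Sum>u\<in>pverts G. \<Sum>v\<in>pverts G. if (u, v) \<in> parcs G then 1 else 0)"
    unfolding labeling_sum[OF \<sigma>, of "\<lambda>v. if (inv_into (pverts G) \<sigma> _, v) \<in> parcs G then 1 else 0"]
    by (rule labeling_sum[OF \<sigma>])
  also have "\<dots> = (\<Sum>a\<in>pverts G \<times> pverts G. if a \<in> parcs G then 1 else 0)"
    by (simp add: sum.cartesian_product case_prod_unfold)
  also have "\<dots> = of_nat (card ((pverts G \<times> pverts G) \<inter> parcs G))"
    using pair_finite_verts by (simp add: sum.If_cases)
  also have "(pverts G \<times> pverts G) \<inter> parcs G = parcs G"
    using in_arcsD1 in_arcsD2 by auto
  finally show ?thesis using card_parcs_eq_twice_graph_size[OF G] by simp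
qed

text \<open>Entries in {0, 1} equal their squared moduli, so the squared norm is the sum of all
  entries.\<close>

lemma frobenius_norm_adjacency_mat:
  assumes G: "pair_graph G" and \<sigma>: "labeling G \<sigma>"
  shows "frobenius_norm (adjacency_mat G \<sigma>) = sqrt (2 * real (graph_size G))"
proof -
  have "complex_of_real (\<Sum>x<graph_order G. \<Sum>y<graph_order G. (cmod (adjacency_mat G \<sigma> $$ (x, y)))\<^sup>2)
      = (\<Sum>x<graph_order G. \<Sum>y<graph_order G. adjacency_mat G \<sigma> $$ (x, y))"
    unfolding of_real_sum by (intro sum.cong) (auto simp: adjacency_mat_def)
  also have "\<dots> = complex_of_real (2 * real (graph_size G))"
    unfolding adjacency_mat_sum[OF G \<sigma>] by simp
  finally show ?thesis
    unfolding frobenius_norm_def of_real_eq_iff by (simp add: adjacency_mat_def)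
qed

theorem corollary2p11:
  fixes G :: "'a pair_pre_digraph"
  assumes "pair_graph G"
    and "graph_size G > 0"
    and "edge_complexity G = graph_energy G / sqrt (2 * real (graph_size G))"
  shows "regular_graph G"
proof -
  \<comment> \<open>Finitely many ratios occur, so some labeling attains the minimum.\<close>
  have "edge_complexity G \<in> {fourier_ratio (adjacency_mat G \<sigma>) | \<sigma>. labeling G \<sigma>}"
    unfolding edge_complexity_def by (intro Min_in edge_complexity_set assms)
  then obtain \<sigma> where \<sigma>: "labeling G \<sigma>"
    and ratio: "edge_complexity G = fourier_ratio (adjacency_mat G \<sigma>)" by blast
  define N where "N = graph_order G"
  define A where "A = adjacency_mat G \<sigma>"
  define F where "F = fourier_mat N"
  define C where "C = F * A * F"
  have A: "A \<in> carrier_mat N N" unfolding A_def N_def by (rule adjacency_mat_carrier)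
  have unitF: "unitary_mat N F" unfolding F_def by (rule unitary_fourier_mat)
  note F = unitary_matD(1)[OF unitF]
  have F': "mat_adjoint F \<in> carrier_mat N N" using F by simp
  have C: "C \<in> carrier_mat N N" unfolding C_def using F A by (metis mult_carrier_mat)
  have "frobenius_norm C = sqrt (2 * real (graph_size G))"
    unfolding C_def frobenius_norm_unitary[OF unitF unitF A]
    unfolding A_def by (rule frobenius_norm_adjacency_mat[OF assms(1) \<sigma>])
  moreover have "fourier_ratio A = entrywise_l1_norm C / frobenius_norm C"
    using A by (simp add: fourier_ratio_def Let_def C_def F_def)
  \<comment> \<open>Both quotients have the denominator
    \<open>sqrt (2 * real (graph_size G))\<close>, which is positive, so the numerators
    agree.\<close>
  ultimately have l1: "entrywise_l1_norm C = mat_energy A"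
    using assms(2,3) ratio graph_energy_eq[OF \<sigma>] by (simp add: A_def)
  \<comment> \<open>Without vertices the sum of all entries would be empty, against positive
    size.\<close>
  have N: "N > 0"
  proof (rule ccontr)
    assume "\<not> N > 0"
    then show False
      using adjacency_mat_sum[OF assms(1) \<sigma>] assms(2) unfolding N_def by simp
  qed
  obtain W where unitW: "unitary_mat N W" and trW: "mat_trace (W * A) = complex_of_real (mat_energy A)"
    using exists_unitary_trace_energy[OF A] .
  note W = unitary_matD(1)[OF unitW]
  define U where "U = mat_adjoint F * W * mat_adjoint F"
  have unitU: "unitary_mat N U"
    unfolding U_def by (intro unitary_mat_mult unitary_mat_adjoint unitF unitW)
  have "mat_trace (U * C) = mat_trace (W * (mat_adjoint F * C * mat_adjoint F))"
    unfolding U_def by (rule mat_trace_conj[OF W F' F' C])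
  also have "mat_adjoint F * C * mat_adjoint F = A"
  proof -
    have "mat_adjoint F * C = (mat_adjoint F * F) * (A * F)"
      unfolding C_def using F F' A by (simp add: assoc_mult_mat[of _ N N _ N _ N])
    then have "mat_adjoint F * C * mat_adjoint F = A * F * mat_adjoint F"
      using unitary_matD[OF unitF] A F by simp
    also have "\<dots> = A * (F * mat_adjoint F)" using A F F' by (rule assoc_mult_mat)
    finally show ?thesis using unitary_matD[OF unitF] A by simp
  qed
  finally have trU: "mat_trace (U * C) = complex_of_real (entrywise_l1_norm C)"
    using trW l1 by simp
  \<comment> \<open>Removing only the right factor \<open>F\<close> leaves \<open>F * A\<close>,
    whose row 0 is proportional to the column sums of \<open>A\<close>, since row 0 of
    \<open>F\<close> is constant.\<close>
  have CF: "C * mat_adjoint F = F * A"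
  proof -
    have "C * mat_adjoint F = F * A * (F * mat_adjoint F)"
      unfolding C_def using F F' A by (intro assoc_mult_mat) auto
    then show ?thesis using unitary_matD[OF unitF] A F by simp
  qed
  define r where "r = complex_of_real (sqrt (real N))"
  have r0: "r \<noteq> 0" using N by (simp add: r_def)
  have FA: "(F * A) $$ (0, y) = (\<Sum>x<N. A $$ (x, y)) / r" if "y < N" for y
    using that F A N
    by (subst index_mult_mat_sum[of _ N N _ N])
      (auto simp: F_def fourier_mat_row_0 r_def sum_divide_distrib)
  have F0: "F $$ (y, 0) = 1 / r" if "y < N" for y
    using that by (simp add: F_def fourier_mat_col_0 r_def)
  have "C $$ (0, 0) = (\<Sum>y<N. (F * A) $$ (0, y) * F $$ (y, 0))"
    unfolding C_def using F A N by (intro index_mult_mat_sum) auto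
  also have "\<dots> = (\<Sum>y<N. (\<Sum>x<N. A $$ (x, y)) / (r * r))"
    by (intro sum.cong refl) (simp add: FA F0)
  also have "\<dots> = (\<Sum>y<N. \<Sum>x<N. A $$ (x, y)) / (r * r)"
    by (rule sum_divide_distrib[symmetric])
  also have "(\<Sum>y<N. \<Sum>x<N. A $$ (x, y)) = of_nat (2 * graph_size G)"
    unfolding adjacency_mat_sum[OF assms(1) \<sigma>, symmetric] A_def N_def by (rule sum.swap)
  finally have C00: "C $$ (0, 0) \<noteq> 0" using r0 assms(2) by simp
  have C0: "C $$ (0, k) = 0" if k: "k < N" "k \<noteq> 0" for k
  proof (rule ccontr)
    assume "C $$ (0, k) \<noteq> 0"
    \<comment> \<open>The trace pairs entry \<open>(0, k)\<close> of \<open>C\<close> with the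
      transposed entry \<open>(k, 0)\<close> of \<open>U\<close>, so two nonzero entries in row 0 of
      \<open>C\<close> would put two unimodular entries in column 0 of \<open>U\<close>.\<close>
    then have "cmod (U $$ (k, 0)) = 1" "cmod (U $$ (0, 0)) = 1"
      using unitary_trace_l1_extremal[OF C unitU trU] N k(1) C00 by auto
    then show False using unitary_mat_col_single[OF unitU k(1) N N] k(2) by simp
  qed
  have const: "(\<Sum>x<N. A $$ (x, y)) = C $$ (0, 0)" if y: "y < N" for y
  proof -
    have "(\<Sum>x<N. A $$ (x, y)) / r = (C * mat_adjoint F) $$ (0, y)"
      unfolding CF FA[OF y] ..
    also have "\<dots> = (\<Sum>k<N. C $$ (0, k) * mat_adjoint F $$ (k, y))"
      using C F' N y by (intro index_mult_mat_sum) auto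
    \<comment> \<open>Only \<open>k = 0\<close> survives, and row 0 of the adjoint is constantly
      \<open>1 / r\<close>; hence the value does not depend on \<open>y\<close>.\<close>
    also have "\<dots> = (\<Sum>k<N. if k = 0 then C $$ (0, 0) / r else 0)"
      using F y by (intro sum.cong) (auto simp: C0 index_mat_adjoint F_def fourier_mat_col_0 r_def)
    also have "\<dots> = C $$ (0, 0) / r" using N by simp
    finally show ?thesis using r0 by simp
  qed
  have "complex_of_real (real (degree_of G v)) = C $$ (0, 0)" if "v \<in> pverts G" for v
  proof -
    have "\<sigma> v < N" using \<sigma> that by (auto simp: labeling_def bij_betw_def N_def)
    then show ?thesis
      using const adjacency_mat_col_sum[OF assms(1) \<sigma> that] by (simp add: A_def N_def)
  qed
  \<comment> \<open>The common value is known only as a complex number; the floor of its real part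
    recovers the natural number that witnesses regularity.\<close>
  then have "degree_of G v = nat \<lfloor>Re (C $$ (0, 0))\<rfloor>" if "v \<in> pverts G" for v
    using that by (metis Re_complex_of_real floor_of_nat nat_int)
  then show ?thesis unfolding regular_graph_def by blast
qed

end
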